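(* Let $\mathbf A\in\mathbb R^{m\times n}$ be nonzero and $\mathbf b\in\mathbb R^m$ (the system $\mathbf A\mathbf x=\mathbf b$ may be consistent or inconsistent), and let $\alpha_{\rm c}$ satisfy $0<\alpha_{\rm c}<2/\lambda_{\max}^{\rm c}$. For arbitrary $\mathbf x^0\in\mathbb R^n$ and every $k\ge0$, the $k$th iterate $\mathbf x^k$ of the block column sampling iterative (BCSI) algorithm with stepsize $\alpha_{\rm c}$ satisfies $$\mathbb E\left[\|\mathbf A(\mathbf x^k-\mathbf A^\dagger\mathbf b)\|^2\right]\leq \eta_{\rm c}^k\,\|\mathbf A(\mathbf x^0-\mathbf A^\dagger\mathbf b)\|^2,$$ where $$\eta_{\rm c}=1-\alpha_{\rm c}(2-\alpha_{\rm c}\lambda_{\max}^{\rm c})\sigma_{\min}^2(\mathbf A).$$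
   Context: Notation: $\|\cdot\|$ is the Euclidean norm, $\mathbf A^\dagger$ is the Moore--Penrose pseudoinverse, $\sigma_{\min}(\mathbf A)$ is the smallest nonzero singular value of $\mathbf A$, and $\lambda_{\max}(\cdot)$ is the largest eigenvalue of a symmetric matrix. BCSI algorithm: let $\mathcal D_{\rm c}$ be a (discrete or continuous) distribution of random real matrices $\mathbf T$ with $n$ rows (the number of columns may itself be random) such that $\mathbb E[\mathbf T\mathbf T^\top]=\mathbf I$. Given $\mathbf x^0\in\mathbb R^n$ (deterministic) and a stepsize $\alpha_{\rm c}>0$, for $k\ge1$, $$\mathbf x^k=\mathbf x^{k-1}-\alpha_{\rm c}\mathbf T\mathbf T^\top\mathbf A^\top(\mathbf A\mathbf x^{k-1}-\mathbf b),$$ where at each iteration a fresh $\mathbf T\sim\mathcal D_{\rm c}$ is drawn, independently of all previous iterations. Define $\lambda_{\max}^{\rm c}=\max_{\mathbf T\sim\mathcal D_{\rm c}}\lambda_{\max}(\mathbf A\mathbf T\mathbf T^\top\mathbf A^\top)$, the maximum being over the possible realizations of $\mathbf T$; this maximum is assumed to exist (in particular to be finite). *)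

theory Defs
  imports "HOL-Probability.Probability"
begin

section \<open>Spectral quantities and the Moore--Penrose pseudoinverse\<close>

definition eigenvalues :: "real^'n^'n \<Rightarrow> real set" where
  "eigenvalues M = {\<mu>. \<exists>v. v \<noteq> 0 \<and> M *v v = \<mu> *\<^sub>R v}"

definition lambda_max :: "real^'n^'n \<Rightarrow> real" where
  "lambda_max M = Max (eigenvalues M)"

definition singular_values :: "real^'n^'m \<Rightarrow> real set" where
  "singular_values A = sqrt ` eigenvalues (transpose A ** A)"

definition sigma_min :: "real^'n^'m \<Rightarrow> real" where
  "sigma_min A = Min (singular_values A - {0})"

definition is_pinv :: "real^'n^'m \<Rightarrow> real^'m^'n \<Rightarrow> bool" where
  "is_pinv A X \<longleftrightarrow>
     A ** X ** A = A \<and> X ** A ** X = X \<and>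
     transpose (A ** X) = A ** X \<and> transpose (X ** A) = X ** A"

definition pinv :: "real^'n^'m \<Rightarrow> real^'m^'n" where
  "pinv A = (THE X. is_pinv A X)"


section \<open>Random matrices with a random number of columns\<close>

text \<open>
  A real matrix with rows indexed by \<open>'n\<close> and an arbitrary finite number \<open>l\<close> of columns is
  encoded as a pair \<open>(l, c)\<close>, where \<open>c j\<close> is the \<open>j\<close>-th column for \<open>j < l\<close>. Padding by zero makes
  the encoding unique. With the product topology on the pair type, the set of well-formed
  encodings is closed, and its subspace topology is that of the disjoint union over \<open>l\<close> of the
  spaces of matrices with \<open>l\<close> columns.
\<close>

type_synonym 'n colmat = "nat \<times> (nat \<Rightarrow> real^'n)"

definition wf_colmat :: "('n::finite) colmat \<Rightarrow> bool" where
  "wf_colmat T \<longleftrightarrow> (\<forall>j\<ge>fst T. snd T j = 0)"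

text \<open>The matrix \<open>T T\<^sup>\<top>\<close>.\<close>

definition outer_gram :: "('n::finite) colmat \<Rightarrow> real^'n^'n" where
  "outer_gram T = (\<chi> i j. \<Sum>c<fst T. snd T c $ i * snd T c $ j)"

definition column_sampling_distribution :: "('n::finite) colmat measure \<Rightarrow> bool" where
  "column_sampling_distribution D \<longleftrightarrow>
     prob_space D \<and> sets D = sets borel \<and> (AE T in D. wf_colmat T) \<and>
     has_bochner_integral D outer_gram (mat 1)"

text \<open>
  The possible realizations under a distribution \<open>D\<close> are the points of its topological support.
  For a discrete \<open>D\<close> this is the closure of the set of atoms; by continuity, if the maximum in
  \<open>lambda_max_c\<close> below exists over the atoms, then it exists over the support with the same value.
\<close>

definition realizations :: "'a::topological_space measure \<Rightarrow> 'a set" where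
  "realizations D = {x. \<forall>U. open U \<and> x \<in> U \<longrightarrow> emeasure D U > 0}"

definition block_lambdas :: "real^'n^'m \<Rightarrow> 'n colmat measure \<Rightarrow> real set" where
  "block_lambdas A D =
     (\<lambda>T. lambda_max (A ** outer_gram T ** transpose A)) ` realizations D"

definition has_maximum :: "real set \<Rightarrow> bool" where
  "has_maximum S \<longleftrightarrow> (\<exists>s\<in>S. \<forall>t\<in>S. t \<le> s)"

text \<open>\<^const>\<open>Max\<close> is not usable here, since \<open>block_lambdas A D\<close> may be infinite.\<close>

definition lambda_max_c :: "real^'n^'m \<Rightarrow> 'n colmat measure \<Rightarrow> real" where
  "lambda_max_c A D = (GREATEST \<mu>. \<mu> \<in> block_lambdas A D)"


section \<open>The block column sampling iteration\<close>

text \<open>\<open>T k\<close> is the matrix drawn in iteration \<open>k \<ge> 1\<close>; the value \<open>T 0\<close> is never used.\<close>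

primrec bcsi ::
  "real^'n^'m \<Rightarrow> real^'m \<Rightarrow> real \<Rightarrow> real^'n \<Rightarrow> (nat \<Rightarrow> 'n colmat) \<Rightarrow> nat \<Rightarrow> real^'n" where
  "bcsi A b \<alpha> x0 T 0 = x0"
| "bcsi A b \<alpha> x0 T (Suc k) =
     bcsi A b \<alpha> x0 T k -
     \<alpha> *\<^sub>R (outer_gram (T (Suc k)) *v (transpose A *v (A *v bcsi A b \<alpha> x0 T k - b)))"

definition eta_c :: "real^'n^'m \<Rightarrow> 'n colmat measure \<Rightarrow> real \<Rightarrow> real" where
  "eta_c A D \<alpha> = 1 - \<alpha> * (2 - \<alpha> * lambda_max_c A D) * (sigma_min A)\<^sup>2"

end

theory Submission
  imports Defs
begin

text \<open>
  Write \<open>e\<^sub>k = A (x\<^sup>k - A\<^sup>\<dagger> b)\<close>. By the normal equation \<open>A\<^sup>\<top> A A\<^sup>\<dagger> b = A\<^sup>\<top> b\<close>, one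
  iteration is the gradient step \<open>e\<^sub>k\<^sub>+\<^sub>1 = e\<^sub>k - \<alpha> B e\<^sub>k\<close> with \<open>B = A T T\<^sup>\<top> A\<^sup>\<top>\<close>. Almost surely
  \<open>T\<close> lies in the support of its distribution, so that \<open>0 \<le> B \<le> \<lambda>\<close> for \<open>\<lambda> = \<lambda>\<^sub>m\<^sub>a\<^sub>x\<close> and hence
  \<open>B\<^sup>2 \<le> \<lambda> B\<close>; the step decreases \<open>\<parallel>e\<parallel>\<^sup>2\<close> by at least \<open>\<alpha> (2 - \<alpha> \<lambda>) (e \<bullet> B e)\<close>. As \<open>T\<close> is
  independent of the past and \<open>\<bbbE>[T T\<^sup>\<top>] = I\<close>, the expectation of \<open>e \<bullet> B e\<close> is that of
  \<open>\<parallel>A\<^sup>\<top> e\<parallel>\<^sup>2\<close>, which is at least \<open>\<sigma>\<^sub>m\<^sub>i\<^sub>n\<^sup>2 \<parallel>e\<parallel>\<^sup>2\<close> because \<open>e\<close> lies in the range of \<open>A\<close>.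
\<close>

section \<open>Extremal eigenvalues and quadratic forms\<close>

lemma inner_matrix_vector_transpose:
  fixes A :: "real^'n^'m"
  shows "x \<bullet> (A *v y) = (transpose A *v x) \<bullet> y"
  by (simp add: dot_lmul_matrix)

text \<open>The Rayleigh quotient attains its minimum on the compact unit sphere of
  \<open>W\<close>, and a minimizer is an eigenvector because the gradient vanishes there.
  Invariance of \<open>W\<close> keeps the gradient inside \<open>W\<close>. The lemma serves the
  whole space as well as the range of a matrix.\<close>

lemma self_adjoint_min_eigenvector:
  fixes f :: "'a::euclidean_space \<Rightarrow> 'a"
  assumes lin: "linear f" and adj: "\<And>x y. x \<bullet> f y = f x \<bullet> y"
    and W: "subspace W" "\<And>x. x \<in> W \<Longrightarrow> f x \<in> W" and w: "w \<in> W" "w \<noteq> 0"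
  obtains v \<mu> where "v \<in> W" "v \<noteq> 0" "f v = \<mu> *\<^sub>R v" "\<And>x. x \<in> W \<Longrightarrow> \<mu> * (norm x)\<^sup>2 \<le> x \<bullet> f x"
proof -
  have compact: "compact (sphere 0 1 \<inter> W)"
    using W(1) by (intro compact_Int_closed closed_subspace) auto
  have "w /\<^sub>R norm w \<in> sphere 0 1 \<inter> W"
    using w W(1) by (auto simp: subspace_scale)
  then have ne: "sphere 0 1 \<inter> W \<noteq> {}" by blast
  have "continuous_on (sphere 0 1 \<inter> W) (\<lambda>x. x \<bullet> f x)"
    using lin by (intro continuous_on_inner continuous_on_id linear_continuous_on)
      (simp add: linear_conv_bounded_linear)
  from continuous_attains_inf[OF compact ne this]
  obtain v where v: "v \<in> sphere 0 1 \<inter> W"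
    and min: "\<And>x. x \<in> sphere 0 1 \<inter> W \<Longrightarrow> v \<bullet> f v \<le> x \<bullet> f x"
    by blast
  define \<mu> where "\<mu> = v \<bullet> f v"
  define q where "q x = x \<bullet> f x - \<mu> * (x \<bullet> x)" for x
  have q_nonneg: "q x \<ge> 0" if "x \<in> W" for x
  proof (cases "x = 0")
    case False
    have "\<mu> \<le> (x /\<^sub>R norm x) \<bullet> f (x /\<^sub>R norm x)"
      unfolding \<mu>_def using False that W(1) by (intro min) (auto simp: subspace_scale)
    then have "\<mu> \<le> (x \<bullet> f x) / (norm x)\<^sup>2"
      by (simp add: linear_scale[OF lin] power2_eq_square field_simps)
    then show ?thesis
      using False by (simp add: q_def field_simps power2_norm_eq_inner)
  qed (simp add: q_def linear_0[OF lin])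
  \<comment> \<open>\<open>g\<close> is half the gradient of \<open>q\<close> at \<open>v\<close>.
    Since \<open>q\<close> is nonnegative on \<open>W\<close> and vanishes at \<open>v\<close>, a
    step along \<open>- g\<close> cannot decrease it, which forces \<open>g = 0\<close>.\<close>
  define g where "g = f v - \<mu> *\<^sub>R v"
  have gW: "g \<in> W"
    unfolding g_def using v W by (auto intro: subspace_diff subspace_scale)
  have expand: "q (v - t *\<^sub>R g) = t * (t * q g - 2 * (g \<bullet> g))" for t
  proof -
    have "v \<bullet> v = 1" using v by (simp add: norm_eq_1)
    moreover have "v \<bullet> f g = f v \<bullet> g" by (rule adj)
    ultimately have "q (v - t *\<^sub>R g) = t * (t * q g - 2 * (g \<bullet> f v - \<mu> * (g \<bullet> v)))"
      by (simp add: q_def \<mu>_def linear_diff[OF lin] linear_scale[OF lin] inner_diff_left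
          inner_diff_right inner_commute algebra_simps)
    also have "g \<bullet> f v - \<mu> * (g \<bullet> v) = g \<bullet> g"
      by (simp add: g_def inner_diff_right)
    finally show ?thesis .
  qed
  have "g = 0"
  proof (rule ccontr)
    assume "g \<noteq> 0"
    then have gg: "g \<bullet> g > 0" by simp
    have c: "q g \<ge> 0" by (rule q_nonneg[OF gW])
    \<comment> \<open>This step length gives \<open>t * q g < g \<bullet> g\<close>, so that the
      second factor in \<open>expand\<close> is negative; the \<open>+ 1\<close> keeps the
      denominator positive when \<open>q g = 0\<close>.\<close>
    define t where "t = (g \<bullet> g) / (q g + 1)"
    have t: "t > 0" using gg c by (simp add: t_def)
    have "t * (q g + 1) = g \<bullet> g" using c by (simp add: t_def)
    then have "t * q g + t = g \<bullet> g" by (simp add: distrib_left)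
    then have "t * q g - 2 * (g \<bullet> g) < 0" using gg t by linarith
    then have "q (v - t *\<^sub>R g) < 0" unfolding expand using t by (rule mult_pos_neg[rotated])
    moreover have "v - t *\<^sub>R g \<in> W" using v gW W(1) by (auto intro: subspace_diff subspace_scale)
    ultimately show False using q_nonneg by fastforce
  qed
  show ?thesis
  proof
    show "v \<in> W" "v \<noteq> 0" using v by auto
    show "f v = \<mu> *\<^sub>R v" using \<open>g = 0\<close> by (simp add: g_def)
    show "\<mu> * (norm x)\<^sup>2 \<le> x \<bullet> f x" if "x \<in> W" for x
      using q_nonneg[OF that] by (simp add: q_def power2_norm_eq_inner)
  qed
qed

text \<open>Eigenvectors for distinct eigenvalues are orthogonal, hence independent, and an
  independent set is finite. \<open>Max\<close> and \<open>Min\<close> in \<open>lambda_max\<close>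
  and \<open>sigma_min\<close> are informative only on finite sets.\<close>

lemma finite_eigenvalues_symmetric:
  fixes S :: "real^'n^'n"
  assumes sym: "transpose S = S"
  shows "finite (eigenvalues S)"
proof -
  define v where "v \<mu> = (SOME v. v \<noteq> 0 \<and> S *v v = \<mu> *\<^sub>R v)" for \<mu>
  have v: "v \<mu> \<noteq> 0 \<and> S *v v \<mu> = \<mu> *\<^sub>R v \<mu>" if "\<mu> \<in> eigenvalues S" for \<mu>
    unfolding v_def by (rule someI_ex) (use that in \<open>simp add: eigenvalues_def\<close>)
  have orth: "v \<mu> \<bullet> v \<nu> = 0" if "\<mu> \<in> eigenvalues S" "\<nu> \<in> eigenvalues S" "\<mu> \<noteq> \<nu>" for \<mu> \<nu>
  proof -
    have "\<nu> * (v \<mu> \<bullet> v \<nu>) = v \<mu> \<bullet> (S *v v \<nu>)" using v[OF that(2)] by simp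
    also have "\<dots> = (S *v v \<mu>) \<bullet> v \<nu>" by (simp add: inner_matrix_vector_transpose sym del: transpose_matrix_vector)
    also have "\<dots> = \<mu> * (v \<mu> \<bullet> v \<nu>)" using v[OF that(1)] by simp
    finally show ?thesis using that(3) by simp
  qed
  have "inj_on v (eigenvalues S)"
    by (rule inj_onI) (metis inner_eq_zero_iff orth v)
  moreover have "finite (v ` eigenvalues S)"
  proof (rule independent_imp_finite[OF pairwise_orthogonal_independent])
    show "pairwise orthogonal (v ` eigenvalues S)"
      unfolding pairwise_def orthogonal_def using orth by blast
    show "0 \<notin> v ` eigenvalues S" using v by auto
  qed
  ultimately show ?thesis by (simp add: finite_image_iff)
qed

text \<open>The minimum principle is applied to \<open>- S\<close> on the whole space: the negated
  minimum is an eigenvalue of \<open>S\<close> that bounds its quadratic form.\<close>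

lemma inner_le_lambda_max:
  fixes S :: "real^'n^'n"
  assumes sym: "transpose S = S"
  shows "x \<bullet> (S *v x) \<le> lambda_max S * (norm x)\<^sup>2"
proof (cases "x = 0")
  case False
  obtain v \<mu> where v: "v \<noteq> 0" "- (S *v v) = \<mu> *\<^sub>R v"
    and min: "\<And>x. \<mu> * (norm x)\<^sup>2 \<le> x \<bullet> - (S *v x)"
    using False
  proof (rule self_adjoint_min_eigenvector[of "\<lambda>x. - (S *v x)" UNIV x, rotated 5])
    show "linear (\<lambda>x. - (S *v x))" by (intro linear_compose_neg) auto
    show "x \<bullet> - (S *v y) = - (S *v x) \<bullet> y" for x y
      using inner_matrix_vector_transpose[of x S y] by (simp add: sym del: transpose_matrix_vector)
  qed auto
  have "S *v v = (- \<mu>) *\<^sub>R v" using v(2) by (metis minus_minus scaleR_minus_left)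
  then have "- \<mu> \<in> eigenvalues S" using v(1) unfolding eigenvalues_def by blast
  then have "- \<mu> \<le> lambda_max S"
    unfolding lambda_max_def by (intro Max_ge finite_eigenvalues_symmetric sym)
  then have "- \<mu> * (norm x)\<^sup>2 \<le> lambda_max S * (norm x)\<^sup>2" by (rule mult_right_mono) simp
  with min[of x] show ?thesis by simp
qed simp

lemma eigenvalue_gram_nonneg:
  fixes A :: "real^'n^'m"
  assumes "\<mu> \<in> eigenvalues (transpose A ** A)"
  shows "\<mu> \<ge> 0"
proof -
  from assms obtain v where v: "v \<noteq> 0" "transpose A *v (A *v v) = \<mu> *\<^sub>R v"
    by (auto simp: eigenvalues_def matrix_vector_mul_assoc simp del: transpose_matrix_vector)
  have "\<mu> * (v \<bullet> v) = (A *v v) \<bullet> (A *v v)"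
    by (metis inner_matrix_vector_transpose inner_scaleR_left v(2))
  also have "\<dots> \<ge> 0" by simp
  finally have "\<mu> * (v \<bullet> v) \<ge> 0" .
  moreover have "v \<bullet> v > 0" using v(1) by simp
  ultimately show ?thesis by (simp add: zero_le_mult_iff)
qed

text \<open>The least eigenvalue \<open>\<mu>\<close> of \<open>A ** transpose A\<close> on the
  range of \<open>A\<close> is nonzero and is also an eigenvalue of \<open>transpose A ** A\<close>,
  so \<open>sqrt \<mu>\<close> is one of the singular values over which \<open>sigma_min\<close>
  minimizes. The restriction to the range excludes the kernel of \<open>transpose A\<close>.\<close>

lemma sigma_min_le_on_range:
  fixes A :: "real^'n^'m"
  assumes "e \<in> range ((*v) A)"
  shows "(sigma_min A)\<^sup>2 * (norm e)\<^sup>2 \<le> (norm (transpose A *v e))\<^sup>2"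
proof (cases "e = 0")
  case False
  have sub: "subspace (range ((*v) A))" by (intro linear_subspace_image) auto
  obtain v \<mu> where v: "v \<in> range ((*v) A)" "v \<noteq> 0" "A *v (transpose A *v v) = \<mu> *\<^sub>R v"
    and min: "\<And>x. x \<in> range ((*v) A) \<Longrightarrow> \<mu> * (norm x)\<^sup>2 \<le> x \<bullet> (A *v (transpose A *v x))"
    using assms False
  proof (rule self_adjoint_min_eigenvector
      [of "\<lambda>x. A *v (transpose A *v x)" "range ((*v) A)" e, rotated 4])
    show "linear (\<lambda>x. A *v (transpose A *v x))"
      by (simp add: matrix_vector_mul_assoc del: transpose_matrix_vector)
    show "x \<bullet> (A *v (transpose A *v y)) = (A *v (transpose A *v x)) \<bullet> y" for x y
      by (metis inner_matrix_vector_transpose inner_commute)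
  qed (use sub in auto)
  define u where "u = transpose A *v v"
  \<comment> \<open>A vector of the range that \<open>transpose A\<close> annihilates is orthogonal
    to itself.\<close>
  have "u \<noteq> 0"
  proof
    assume "u = 0"
    from v(1) obtain z where "v = A *v z" by auto
    then have "v \<bullet> v = u \<bullet> z"
      using inner_matrix_vector_transpose[of v A z] by (simp add: u_def)
    with \<open>u = 0\<close> v(2) show False by simp
  qed
  have "\<mu> * (v \<bullet> v) = u \<bullet> u"
    using inner_matrix_vector_transpose[of v A u] v(3)
    by (simp add: u_def del: transpose_matrix_vector)
  with \<open>u \<noteq> 0\<close> v(2) have "\<mu> \<noteq> 0" by auto
  have "transpose A *v (A *v u) = \<mu> *\<^sub>R u"
    using v(3) by (simp add: u_def matrix_vector_mult_scaleR del: transpose_matrix_vector)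
  with \<open>u \<noteq> 0\<close> have ev: "\<mu> \<in> eigenvalues (transpose A ** A)"
    by (auto simp: eigenvalues_def matrix_vector_mul_assoc simp del: transpose_matrix_vector)
  then have "\<mu> \<ge> 0" by (rule eigenvalue_gram_nonneg)
  have fin: "finite (singular_values A - {0})"
    by (simp add: singular_values_def finite_eigenvalues_symmetric matrix_transpose_mul)
  have mem: "sqrt \<mu> \<in> singular_values A - {0}"
    using ev \<open>\<mu> \<noteq> 0\<close> by (simp add: singular_values_def)
  have "sigma_min A \<le> sqrt \<mu>"
    unfolding sigma_min_def by (rule Min_le[OF fin mem])
  moreover have "sigma_min A \<in> singular_values A"
    using Min_in[OF fin] mem unfolding sigma_min_def by blast
  \<comment> \<open>Squaring the bound needs this sign. As \<open>sqrt\<close> is negative at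
    negative reals, the sign comes from the eigenvalues of the Gram matrix.\<close>
  then have "0 \<le> sigma_min A"
    by (auto simp: singular_values_def eigenvalue_gram_nonneg)
  ultimately have "(sigma_min A)\<^sup>2 \<le> \<mu>"
    using \<open>\<mu> \<ge> 0\<close> by (metis power_mono real_sqrt_pow2)
  then have "(sigma_min A)\<^sup>2 * (norm e)\<^sup>2 \<le> \<mu> * (norm e)\<^sup>2" by (rule mult_right_mono) simp
  also have "\<dots> \<le> e \<bullet> (A *v (transpose A *v e))" by (rule min[OF assms])
  also have "\<dots> = (norm (transpose A *v e))\<^sup>2"
    unfolding inner_matrix_vector_transpose[of e A] by (simp add: power2_norm_eq_inner)
  finally show ?thesis .
qed simp

section \<open>The normal equation and the Moore-Penrose pseudoinverse\<close>

text \<open>Split \<open>b\<close> into its projection onto the range of \<open>A\<close> and an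
  orthogonal remainder; \<open>transpose A\<close> annihilates the remainder.\<close>

lemma normal_equation_solvable:
  fixes A :: "real^'n^'m"
  obtains x where "transpose A *v (A *v x) = transpose A *v b"
proof -
  have sub: "subspace (range ((*v) A))" by (intro linear_subspace_image) auto
  obtain y z where y: "y \<in> span (range ((*v) A))"
    and z: "\<And>w. w \<in> span (range ((*v) A)) \<Longrightarrow> orthogonal z w" and b: "b = y + z"
    using orthogonal_subspace_decomp_exists[of "range ((*v) A)" b] by metis
  obtain x where x: "y = A *v x" using y sub by (auto simp: span_eq_iff[THEN iffD2])
  have "(transpose A *v z) \<bullet> (transpose A *v z) = z \<bullet> (A *v (transpose A *v z))"
    by (simp only: inner_matrix_vector_transpose)
  also have "\<dots> = 0" using z by (simp add: orthogonal_def span_base)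
  finally have "transpose A *v z = 0" by (simp del: transpose_matrix_vector)
  then have "transpose A *v (A *v x) = transpose A *v b"
    by (simp add: b x matrix_vector_right_distrib del: transpose_matrix_vector)
  then show ?thesis by (rule that)
qed

text \<open>Solutions of the normal equation for the unit vectors are the columns of
  \<open>G\<close>, so \<open>transpose A ** A ** G = transpose A\<close>. Transposing gives
  \<open>transpose (A ** G) ** A = A\<close>; multiplied by \<open>G\<close> on the right, this
  writes \<open>A ** G\<close> as a Gram matrix, hence it is symmetric.\<close>

lemma least_squares_inverse_exists:
  fixes A :: "real^'n^'m"
  obtains G :: "real^'m^'n" where "A ** G ** A = A" "transpose (A ** G) = A ** G"
proof -
  have "\<forall>j. \<exists>x. transpose A *v (A *v x) = transpose A *v axis j 1"
    by (metis normal_equation_solvable)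
  then obtain g where g: "\<And>j. transpose A *v (A *v g j) = transpose A *v axis j 1" by metis
  define G :: "real^'m^'n" where "G = (\<chi> i j. g j $ i)"
  have Gj: "G *v axis j 1 = g j" for j
    by (simp add: G_def matrix_vector_mult_basis column_def vec_eq_iff)
  have "(transpose A ** A ** G) *v axis j 1 = transpose A *v axis j 1" for j
    using g[of j] by (simp add: Gj matrix_vector_mul_assoc[symmetric] del: transpose_matrix_vector)
  then have "column j (transpose A ** A ** G) = column j (transpose A)" for j
    by (simp only: matrix_vector_mult_basis)
  then have normal: "transpose A ** A ** G = transpose A"
    by (simp add: column_def vec_eq_iff)
  then have *: "transpose (A ** G) ** A = A"
    by (metis matrix_mul_assoc matrix_transpose_mul transpose_transpose)
  then have sym: "transpose (A ** G) = A ** G"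
    by (metis matrix_mul_assoc matrix_transpose_mul transpose_transpose)
  with * have "A ** G ** A = A" by simp
  with sym show ?thesis by (rule that[rotated])
qed

text \<open>For two pseudoinverses, \<open>A ** P = (A ** Q) ** (A ** P)\<close>; transposing this
  product of symmetric matrices yields \<open>A ** Q\<close>. The same works on the other side, and
  then \<open>X = X ** A ** X = Y ** A ** Y = Y\<close>.\<close>

lemma is_pinv_unique:
  fixes A :: "real^'n^'m"
  assumes X: "is_pinv A X" and Y: "is_pinv A Y"
  shows "X = Y"
proof -
  have *: "A ** P = A ** Q" if "is_pinv A P" "is_pinv A Q" for P Q
    using that unfolding is_pinv_def by (metis matrix_mul_assoc matrix_transpose_mul)
  have **: "P ** A = Q ** A" if "is_pinv A P" "is_pinv A Q" for P Q
    using that unfolding is_pinv_def by (metis matrix_mul_assoc matrix_transpose_mul)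
  show ?thesis
    using *[OF X Y] **[OF X Y] X Y unfolding is_pinv_def by (metis matrix_mul_assoc)
qed

text \<open>One inverse \<open>G\<close> makes \<open>A ** G\<close> symmetric; another,
  \<open>K\<close>, obtained from \<open>transpose A\<close>, makes \<open>K ** A\<close> symmetric.
  The product \<open>K ** A ** G\<close> inherits both properties. With uniqueness, this justifies
  the definite description in \<open>pinv\<close>.\<close>

lemma is_pinv_pinv:
  fixes A :: "real^'n^'m"
  shows "is_pinv A (pinv A)"
proof -
  obtain G where G: "A ** G ** A = A" "transpose (A ** G) = A ** G"
    by (rule least_squares_inverse_exists)
  obtain H where H: "transpose A ** H ** transpose A = transpose A"
      "transpose (transpose A ** H) = transpose A ** H"
    by (rule least_squares_inverse_exists)
  define K where "K = transpose H"
  have K: "A ** K ** A = A" "transpose (K ** A) = K ** A"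
    using H unfolding K_def by (metis matrix_mul_assoc matrix_transpose_mul transpose_transpose)+
  have AX: "A ** (K ** A ** G) = A ** G" using K(1) by (metis matrix_mul_assoc)
  have XA: "K ** A ** G ** A = K ** A" using G(1) by (metis matrix_mul_assoc)
  have "is_pinv A (K ** A ** G)"
    unfolding is_pinv_def AX XA using G K by (metis AX matrix_mul_assoc)
  then show ?thesis
    unfolding pinv_def by (metis is_pinv_unique theI)
qed

lemma transpose_mult_pinv:
  fixes A :: "real^'n^'m"
  shows "transpose A *v (A *v (pinv A *v b)) = transpose A *v b"
proof -
  have "transpose A ** (A ** pinv A) = transpose A"
    using is_pinv_pinv[of A] unfolding is_pinv_def by (metis matrix_transpose_mul)
  then show ?thesis
    by (simp add: matrix_vector_mul_assoc matrix_mul_assoc del: transpose_matrix_vector)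
qed

section \<open>The deterministic gradient step\<close>

lemma transpose_outer_gram: "transpose (outer_gram T) = outer_gram T"
  by (simp add: outer_gram_def transpose_def vec_eq_iff mult.commute)

text \<open>The form is the sum, over the columns of \<open>T\<close>, of their squared inner
  products with \<open>y\<close>.\<close>

lemma inner_outer_gram_nonneg: "y \<bullet> (outer_gram T *v y) \<ge> 0"
proof -
  have "y \<bullet> (outer_gram T *v y) = (\<Sum>i\<in>UNIV. \<Sum>j\<in>UNIV. \<Sum>c<fst T. (snd T c $ i * y $ i) * (snd T c $ j * y $ j))"
    by (simp add: outer_gram_def inner_vec_def matrix_vector_mult_def sum_distrib_left
        sum_distrib_right mult_ac)
  also have "\<dots> = (\<Sum>i\<in>UNIV. \<Sum>c<fst T. \<Sum>j\<in>UNIV. (snd T c $ i * y $ i) * (snd T c $ j * y $ j))"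
    by (intro sum.cong refl sum.swap)
  also have "\<dots> = (\<Sum>c<fst T. \<Sum>i\<in>UNIV. \<Sum>j\<in>UNIV. (snd T c $ i * y $ i) * (snd T c $ j * y $ j))"
    by (rule sum.swap)
  also have "\<dots> = (\<Sum>c<fst T. (snd T c \<bullet> y)\<^sup>2)"
    by (simp add: inner_vec_def power2_eq_square sum_product)
  also have "\<dots> \<ge> 0" by (simp add: sum_nonneg)
  finally show ?thesis .
qed

text \<open>Expanding the square leaves the quadratic term in \<open>B *v e\<close>, which is at
  most \<open>L\<close> times the form of \<open>B\<close> at \<open>e\<close>. Its factor is the
  square of \<open>\<alpha>\<close>, so any real \<open>\<alpha>\<close> is allowed.\<close>

lemma gradient_step_norm_le:
  fixes B :: "real^'n^'n"
  assumes sym: "transpose B = B" and psd: "\<And>x. 0 \<le> x \<bullet> (B *v x)"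
    and bound: "\<And>x. x \<bullet> (B *v x) \<le> L * (norm x)\<^sup>2" and "L > 0"
  shows "(norm (e - \<alpha> *\<^sub>R (B *v e)))\<^sup>2 \<le> (norm e)\<^sup>2 - \<alpha> * (2 - \<alpha> * L) * (e \<bullet> (B *v e))"
proof -
  define u where "u = B *v e"
  define q where "q = e \<bullet> u"
  have eBu: "e \<bullet> (B *v u) = u \<bullet> u"
    using inner_matrix_vector_transpose[of e B u] by (simp add: sym u_def del: transpose_matrix_vector)
  \<comment> \<open>\<open>L B - B\<^sup>2\<close> is positive semidefinite: test \<open>B\<close> at \<open>L e - B e\<close>.\<close>
  have "0 \<le> (L *\<^sub>R e - u) \<bullet> (B *v (L *\<^sub>R e - u))" by (rule psd)
  also have "\<dots> = L\<^sup>2 * q - 2 * L * (u \<bullet> u) + u \<bullet> (B *v u)"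
    using eBu by (simp add: matrix_vector_mult_diff_distrib matrix_vector_mult_scaleR u_def[symmetric]
        inner_diff_left inner_diff_right q_def inner_commute power2_eq_square algebra_simps)
  also have "\<dots> \<le> L\<^sup>2 * q - L * (u \<bullet> u)"
    using bound[of u] by (simp add: power2_norm_eq_inner)
  finally have "L * (u \<bullet> u) \<le> L * (L * q)" by (simp add: power2_eq_square)
  then have uu: "u \<bullet> u \<le> L * q" using \<open>L > 0\<close> by simp
  have "(norm (e - \<alpha> *\<^sub>R u))\<^sup>2 = (norm e)\<^sup>2 - 2 * \<alpha> * q + \<alpha>\<^sup>2 * (u \<bullet> u)"
    unfolding power2_norm_eq_inner
    by (simp add: inner_diff_left inner_diff_right q_def inner_commute
        power2_eq_square algebra_simps)
  also have "\<dots> \<le> (norm e)\<^sup>2 - 2 * \<alpha> * q + \<alpha>\<^sup>2 * (L * q)"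
    using uu by (simp add: mult_left_mono)
  also have "\<dots> = (norm e)\<^sup>2 - \<alpha> * (2 - \<alpha> * L) * q"
    by (simp add: power2_eq_square algebra_simps)
  finally show ?thesis by (simp add: u_def q_def)
qed

section \<open>Support, measurability and independence\<close>

text \<open>Each point outside the support has a basic open neighbourhood of measure zero. A
  countable basis has only countably many of these, so their union is a null set.\<close>

lemma AE_in_realizations:
  fixes D :: "'a::second_countable_topology measure"
  assumes sets: "sets D = sets borel"
  shows "AE x in D. x \<in> realizations D"
proof -
  obtain \<B> :: "'a set set" where \<B>: "countable \<B>" "topological_basis \<B>"
    using ex_countable_basis by blast
  define N where "N = (\<Union>B\<in>{B\<in>\<B>. emeasure D B = 0}. B)"
  have "N \<in> null_sets D"
    unfolding N_def
  proof (intro null_sets_UN')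
    show "countable {B \<in> \<B>. emeasure D B = 0}" using \<B>(1) by simp
    show "B \<in> null_sets D" if "B \<in> {B \<in> \<B>. emeasure D B = 0}" for B
      using that topological_basis_open[OF \<B>(2)] by (auto simp: sets null_sets_def)
  qed
  moreover have "x \<in> N" if x: "x \<notin> realizations D" for x
  proof -
    from x obtain U where U: "open U" "x \<in> U" "emeasure D U = 0"
      by (auto simp: realizations_def)
    then obtain B where B: "B \<in> \<B>" "x \<in> B" "B \<subseteq> U"
      using topological_basisE[OF \<B>(2)] by metis
    then have "emeasure D B \<le> emeasure D U"
      using U(1) by (intro emeasure_mono) (auto simp: sets)
    with B U(3) show ?thesis by (auto simp: N_def)
  qed
  ultimately show ?thesis
    by (intro AE_I'[of N]) auto
qed

text \<open>Existence of the maximum is what makes \<open>GREATEST\<close> denote it.\<close>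

lemma le_lambda_max_c:
  assumes "has_maximum (block_lambdas A D)" and "T \<in> realizations D"
  shows "lambda_max (A ** outer_gram T ** transpose A) \<le> lambda_max_c A D"
proof -
  obtain s where s: "s \<in> block_lambdas A D" "\<And>t. t \<in> block_lambdas A D \<Longrightarrow> t \<le> s"
    using assms(1) by (auto simp: has_maximum_def)
  then have "lambda_max_c A D = s"
    unfolding lambda_max_c_def by (intro Greatest_equality)
  with s(2) assms(2) show ?thesis by (auto simp: block_lambdas_def)
qed

lemma borel_measurable_matrix_vector_mult:
  fixes f :: "'a \<Rightarrow> real^'n^'m" and g :: "'a \<Rightarrow> real^'n"
  assumes "f \<in> borel_measurable M" "g \<in> borel_measurable M"
  shows "(\<lambda>x. f x *v g x) \<in> borel_measurable M"
  using assms
  by (rule borel_measurable_continuous_Pair)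
    (auto simp: matrix_vector_mult_def intro!: continuous_intros)

lemma integrable_norm_matrix_vector_mult:
  fixes C :: "real^'n^'m" and X :: "'a \<Rightarrow> real^'n"
  assumes X: "X \<in> borel_measurable M" and int: "integrable M (\<lambda>x. (norm (X x))\<^sup>2)"
  shows "integrable M (\<lambda>x. (norm (C *v X x))\<^sup>2)"
proof -
  obtain K where K: "\<And>x. norm (C *v x) \<le> norm x * K"
    using bounded_linear.bounded[OF matrix_vector_mul_bounded_linear[of C]] by blast
  have bound: "(norm (C *v X x))\<^sup>2 \<le> (norm (X x) * K)\<^sup>2" for x
    by (rule power_mono[OF K]) simp
  have "integrable M (\<lambda>x. (norm (X x))\<^sup>2 * K\<^sup>2)" using int by simp
  moreover have "(\<lambda>x. C *v X x) \<in> borel_measurable M"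
    by (intro borel_measurable_matrix_vector_mult X borel_measurable_const)
  then have "(\<lambda>x. (norm (C *v X x))\<^sup>2) \<in> borel_measurable M" by measurable
  moreover have "AE x in M. norm ((norm (C *v X x))\<^sup>2) \<le> norm ((norm (X x))\<^sup>2 * K\<^sup>2)"
    using bound by (simp add: power_mult_distrib)
  ultimately show ?thesis by (rule Bochner_Integration.integrable_bound)
qed

text \<open>This allows the draws to be restricted to \<open>{1..k}\<close>, the form in which
  independence of blocks is available.\<close>

lemma bcsi_cong:
  assumes "\<And>j. 1 \<le> j \<Longrightarrow> j \<le> k \<Longrightarrow> S j = T j"
  shows "bcsi A b \<alpha> x0 S k = bcsi A b \<alpha> x0 T k"
  using assms by (induction k) auto

lemma measurable_bcsi:
  fixes A :: "real^'n^'m"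
  assumes "(outer_gram :: 'n colmat \<Rightarrow> _) \<in> borel_measurable borel" and "{1..k} \<subseteq> J"
  shows "(\<lambda>\<tau>. bcsi A b \<alpha> x0 \<tau> k) \<in> borel_measurable (PiM J (\<lambda>_. borel))"
  using assms(2)
proof (induction k)
  case (Suc k)
  then have [measurable]: "(\<lambda>\<tau>. bcsi A b \<alpha> x0 \<tau> k) \<in> borel_measurable (PiM J (\<lambda>_. borel))"
    by (simp add: subset_iff)
  have "(\<lambda>\<tau>. \<tau> (Suc k)) \<in> PiM J (\<lambda>_. borel) \<rightarrow>\<^sub>M (borel :: 'n colmat measure)"
    using Suc.prems by (intro measurable_component_singleton) auto
  then have G: "(\<lambda>\<tau>. outer_gram (\<tau> (Suc k)) :: real^'n^'n) \<in> borel_measurable (PiM J (\<lambda>_. borel))"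
    by (rule measurable_compose[OF _ assms(1)])
  show ?case
    unfolding bcsi.simps
    by (intro borel_measurable_diff borel_measurable_scaleR borel_measurable_const
        borel_measurable_matrix_vector_mult G Suc) (use Suc.prems in \<open>auto simp: subset_iff\<close>)
qed simp

context prob_space
begin

text \<open>Entrywise, independence factors the expectation of each summand; the mean
  \<open>mat 1\<close> of \<open>G\<close> then removes the off-diagonal terms and leaves the second
  moments of the entries of \<open>Y\<close>.\<close>

lemma expectation_quadratic_form_indep:
  fixes Y :: "'a \<Rightarrow> real^'n" and G :: "'a \<Rightarrow> real^'n^'n"
  assumes Y [measurable]: "Y \<in> borel_measurable M"
    and ind: "\<And>i j. indep_var borel (\<lambda>\<omega>. Y \<omega> $ i * Y \<omega> $ j) borel (\<lambda>\<omega>. G \<omega> $ i $ j)"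
    and Y2: "integrable M (\<lambda>\<omega>. (norm (Y \<omega>))\<^sup>2)"
    and G: "has_bochner_integral M G (mat 1)"
  shows "has_bochner_integral M (\<lambda>\<omega>. Y \<omega> \<bullet> (G \<omega> *v Y \<omega>)) (expectation (\<lambda>\<omega>. (norm (Y \<omega>))\<^sup>2))"
proof -
  have YY: "integrable M (\<lambda>\<omega>. Y \<omega> $ i * Y \<omega> $ j)" for i j
  proof (rule Bochner_Integration.integrable_bound[OF Y2])
    show "AE \<omega> in M. norm (Y \<omega> $ i * Y \<omega> $ j) \<le> norm ((norm (Y \<omega>))\<^sup>2)"
      by (simp add: abs_mult power2_eq_square mult_mono component_le_norm_cart)
  qed (rule indep_var_rv1[OF ind])
  have GG: "has_bochner_integral M (\<lambda>\<omega>. G \<omega> $ i $ j) (if i = j then 1 else 0)" for i j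
    using has_bochner_integral_bounded_linear
      [OF bounded_linear_compose[OF bounded_linear_vec_nth[of j] bounded_linear_vec_nth[of i]] G]
    by (simp add: mat_def)
  have "has_bochner_integral M (\<lambda>\<omega>. (Y \<omega> $ i * Y \<omega> $ j) * G \<omega> $ i $ j)
      (if i = j then expectation (\<lambda>\<omega>. (Y \<omega> $ i)\<^sup>2) else 0)" for i j
    using indep_var_integrable[OF ind YY] indep_var_lebesgue_integral[OF ind YY] GG[of i j]
    by (auto simp: has_bochner_integral_iff power2_eq_square)
  then have "has_bochner_integral M (\<lambda>\<omega>. \<Sum>i\<in>UNIV. \<Sum>j\<in>UNIV. (Y \<omega> $ i * Y \<omega> $ j) * G \<omega> $ i $ j)
      (\<Sum>i\<in>UNIV. \<Sum>j\<in>UNIV. if i = j then expectation (\<lambda>\<omega>. (Y \<omega> $ i)\<^sup>2) else 0)"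
    by (intro has_bochner_integral_sum)
  moreover have "(\<Sum>i\<in>UNIV. \<Sum>j\<in>UNIV. if i = j then expectation (\<lambda>\<omega>. (Y \<omega> $ i)\<^sup>2) else 0)
      = expectation (\<lambda>\<omega>. (norm (Y \<omega>))\<^sup>2)"
    unfolding power2_norm_eq_inner using YY by (simp add: inner_vec_def power2_eq_square)
  moreover have "(\<Sum>i\<in>UNIV. \<Sum>j\<in>UNIV. (Y \<omega> $ i * Y \<omega> $ j) * G \<omega> $ i $ j) = Y \<omega> \<bullet> (G \<omega> *v Y \<omega>)" for \<omega>
    by (simp add: inner_vec_def matrix_vector_mult_def sum_distrib_left mult_ac)
  ultimately show ?thesis by simp
qed

end

section \<open>The residual recursion and its contraction in expectation\<close>

text \<open>Inconsistent systems are covered here: under \<open>transpose A\<close>,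
  \<open>b\<close> may be replaced by \<open>A *v (pinv A *v b)\<close>.\<close>

lemma bcsi_residual_Suc:
  fixes A :: "real^'n^'m" and b :: "real^'m" and \<alpha> :: real and x0 :: "real^'n" and \<tau> :: "nat \<Rightarrow> 'n colmat"
  defines "e \<equiv> \<lambda>k. A *v (bcsi A b \<alpha> x0 \<tau> k - pinv A *v b)"
  shows "e (Suc k) = e k - \<alpha> *\<^sub>R ((A ** outer_gram (\<tau> (Suc k)) ** transpose A) *v e k)"
proof -
  have "transpose A *v (A *v bcsi A b \<alpha> x0 \<tau> k - b) = transpose A *v e k"
    using transpose_mult_pinv[of A b]
    by (simp add: e_def matrix_vector_mult_diff_distrib del: transpose_matrix_vector)
  then show ?thesis
    by (simp add: e_def matrix_vector_mult_diff_distrib matrix_vector_mult_scaleR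
        matrix_vector_mul_assoc[symmetric] del: transpose_matrix_vector)
qed

text \<open>The pathwise decrease. The form is evaluated at \<open>transpose A *v e k\<close>, so
  that the fresh draw enters only through \<open>outer_gram\<close> and can be averaged
  separately.\<close>

lemma bcsi_residual_norm_le:
  fixes A :: "real^'n^'m" and b :: "real^'m" and \<alpha> :: real and x0 :: "real^'n" and \<tau> :: "nat \<Rightarrow> 'n colmat"
  defines "e \<equiv> \<lambda>k. A *v (bcsi A b \<alpha> x0 \<tau> k - pinv A *v b)"
  assumes max: "has_maximum (block_lambdas A D)" and real: "\<tau> (Suc k) \<in> realizations D"
    and pos: "lambda_max_c A D > 0"
  shows "(norm (e (Suc k)))\<^sup>2 \<le> (norm (e k))\<^sup>2 - \<alpha> * (2 - \<alpha> * lambda_max_c A D) *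
           ((transpose A *v e k) \<bullet> (outer_gram (\<tau> (Suc k)) *v (transpose A *v e k)))"
proof -
  define G where "G = outer_gram (\<tau> (Suc k))"
  define B where "B = A ** G ** transpose A"
  have inner_B: "x \<bullet> (B *v x) = (transpose A *v x) \<bullet> (G *v (transpose A *v x))" for x
    by (simp add: B_def matrix_vector_mul_assoc[symmetric] inner_matrix_vector_transpose[of _ A]
        del: transpose_matrix_vector)
  have sym: "transpose B = B"
    by (simp add: B_def G_def matrix_transpose_mul transpose_outer_gram matrix_mul_assoc)
  have "(norm (e k - \<alpha> *\<^sub>R (B *v e k)))\<^sup>2
      \<le> (norm (e k))\<^sup>2 - \<alpha> * (2 - \<alpha> * lambda_max_c A D) * (e k \<bullet> (B *v e k))"
  proof (rule gradient_step_norm_le[OF sym _ _ pos])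
    show "0 \<le> x \<bullet> (B *v x)" for x
      unfolding inner_B G_def by (rule inner_outer_gram_nonneg)
    show "x \<bullet> (B *v x) \<le> lambda_max_c A D * (norm x)\<^sup>2" for x
    proof (rule order_trans[OF inner_le_lambda_max[OF sym]])
      show "lambda_max B * (norm x)\<^sup>2 \<le> lambda_max_c A D * (norm x)\<^sup>2"
        using le_lambda_max_c[OF max real] by (simp add: B_def G_def mult_right_mono)
    qed
  qed
  then show ?thesis
    unfolding inner_B unfolding G_def[symmetric] e_def bcsi_residual_Suc B_def .
qed

theorem theorem7:
  fixes A :: "real^'n^'m"
    and b :: "real^'m"
    and x0 :: "real^'n"
    and \<alpha> :: real
    and D :: "'n colmat measure"
    and M :: "'w measure"
    and T :: "nat \<Rightarrow> 'w \<Rightarrow> 'n colmat"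
  assumes "A \<noteq> 0"
    and "column_sampling_distribution D"
    and "has_maximum (block_lambdas A D)"
    and "0 < \<alpha>" and "\<alpha> < 2 / lambda_max_c A D"
    and "prob_space M"
    and "prob_space.indep_vars M (\<lambda>_. borel) T {1..}"
    and "\<And>k. k \<ge> 1 \<Longrightarrow> distr M borel (T k) = D"
  shows "\<forall>k.
    integrable M (\<lambda>\<omega>. (norm (A *v (bcsi A b \<alpha> x0 (\<lambda>j. T j \<omega>) k - pinv A *v b)))\<^sup>2) \<and>
    prob_space.expectation M
        (\<lambda>\<omega>. (norm (A *v (bcsi A b \<alpha> x0 (\<lambda>j. T j \<omega>) k - pinv A *v b)))\<^sup>2)
      \<le> eta_c A D \<alpha> ^ k * (norm (A *v (x0 - pinv A *v b)))\<^sup>2"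
proof -
  interpret prob_space M by fact
  note ind = assms(7) and distr = assms(8)
  define L where "L = lambda_max_c A D"
  define e where "e k \<tau> = A *v (bcsi A b \<alpha> x0 \<tau> k - pinv A *v b)" for k \<tau>
  define X where "X k \<omega> = e k (\<lambda>j. T j \<omega>)" for k \<omega>
  have sets_D: "sets D = sets borel" and gram_D: "has_bochner_integral D outer_gram (mat 1)"
    using assms(2) by (auto simp: column_sampling_distribution_def)
  \<comment> \<open>Measurability comes with Bochner integrability under \<open>D\<close>, whose
    sigma-algebra is the Borel one.\<close>
  have gram [measurable]: "(outer_gram :: 'n colmat \<Rightarrow> _) \<in> borel_measurable borel"
    using borel_measurable_has_bochner_integral[OF gram_D] measurable_cong_sets[OF sets_D refl] by auto
  have T [measurable]: "T k \<in> borel_measurable M" if "k \<ge> 1" for k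
    using ind that by (auto simp: indep_vars_def)
  \<comment> \<open>Since \<open>2 / x \<le> 0\<close> for \<open>x \<le> 0\<close>, the stepsize condition forces \<open>L\<close> to be positive.\<close>
  have "0 < 2 / L" unfolding L_def using assms(4,5) by (rule less_trans)
  then have L: "L > 0" by (simp add: zero_less_divide_iff)
  define c where "c = \<alpha> * (2 - \<alpha> * L)"
  have "\<alpha> * L < 2" using assms(5) L by (simp add: L_def field_simps)
  then have c: "c > 0" using assms(4) by (simp add: c_def)
  have e_meas: "e k \<in> borel_measurable (PiM J (\<lambda>_. borel))" if "{1..k} \<subseteq> J" for k J
    unfolding e_def
    by (intro borel_measurable_matrix_vector_mult borel_measurable_diff borel_measurable_const
        measurable_bcsi gram that)
  \<comment> \<open>\<open>X k\<close> is a function of the first \<open>k\<close> draws alone; for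
    \<open>k = 0\<close> this block is empty.\<close>
  have X_restrict: "X k = (\<lambda>\<omega>. e k (restrict (\<lambda>j. T j \<omega>) {1..k}))" for k
    unfolding X_def e_def
    by (intro ext arg_cong[where f = "\<lambda>x. A *v (x - pinv A *v b)"] bcsi_cong) auto
  have X_meas [measurable]: "X k \<in> borel_measurable M" for k
    unfolding X_restrict
    by (rule measurable_compose[OF measurable_restrict e_meas]) auto
  have X_range: "X k \<omega> \<in> range ((*v) A)" for k \<omega>
    by (simp add: X_def e_def)
  define Q where "Q k \<omega> = (transpose A *v X k \<omega>) \<bullet> (outer_gram (T (Suc k) \<omega>) *v (transpose A *v X k \<omega>))"
    for k \<omega>
  have Q_nonneg: "Q k \<omega> \<ge> 0" for k \<omega>
    unfolding Q_def by (rule inner_outer_gram_nonneg)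
  have step: "AE \<omega> in M. (norm (X (Suc k) \<omega>))\<^sup>2 \<le> (norm (X k \<omega>))\<^sup>2 - c * Q k \<omega>" for k
  proof -
    have "AE \<omega> in M. T (Suc k) \<omega> \<in> realizations D"
    proof (rule AE_distrD[where P = "\<lambda>S. S \<in> realizations D" and f = "T (Suc k)"])
      show "T (Suc k) \<in> borel_measurable M" by (rule T) simp
      have "distr M borel (T (Suc k)) = D" by (rule distr) simp
      then show "AE S in distr M borel (T (Suc k)). S \<in> realizations D"
        using AE_in_realizations[OF sets_D] by (simp only:)
    qed
    then show ?thesis
    proof eventually_elim
      case (elim \<omega>)
      then show ?case
        using bcsi_residual_norm_le[OF assms(3), of "\<lambda>j. T j \<omega>" k] L
        by (simp add: X_def e_def Q_def c_def L_def)
    qed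
  qed
  have Q_integral: "has_bochner_integral M (Q k) (expectation (\<lambda>\<omega>. (norm (transpose A *v X k \<omega>))\<^sup>2))"
    if int: "integrable M (\<lambda>\<omega>. (norm (X k \<omega>))\<^sup>2)" for k
    unfolding Q_def
  proof (rule expectation_quadratic_form_indep)
    show meas: "(\<lambda>\<omega>. transpose A *v X k \<omega>) \<in> borel_measurable M"
      by (intro borel_measurable_matrix_vector_mult X_meas borel_measurable_const)
    show "has_bochner_integral M (\<lambda>\<omega>. outer_gram (T (Suc k) \<omega>)) (mat 1)"
      using gram_D unfolding distr[of "Suc k", symmetric, simplified]
      by (simp add: has_bochner_integral_iff integrable_distr_eq integral_distr)
    show "integrable M (\<lambda>\<omega>. (norm (transpose A *v X k \<omega>))\<^sup>2)"
      by (rule integrable_norm_matrix_vector_mult[OF X_meas int])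
    show "indep_var borel (\<lambda>\<omega>. (transpose A *v X k \<omega>) $ i * (transpose A *v X k \<omega>) $ j)
        borel (\<lambda>\<omega>. outer_gram (T (Suc k) \<omega>) $ i $ j)" for i j
    proof -
      have 1: "(\<lambda>\<tau>. transpose A *v e k \<tau>) \<in> borel_measurable (PiM {1..k} (\<lambda>_. borel))"
        by (intro borel_measurable_matrix_vector_mult e_meas borel_measurable_const) simp
      have 2: "(\<lambda>\<tau>. outer_gram (\<tau> (Suc k)) :: real^'n^'n) \<in> borel_measurable (PiM {Suc k} (\<lambda>_. borel))"
        by (rule measurable_compose[OF _ gram]) (rule measurable_component_singleton, simp)
      have vec_nth: "(\<lambda>x::real^'n. x $ i) \<in> borel_measurable borel"
        "(\<lambda>x::real^'n^'n. x $ i $ j) \<in> borel_measurable borel" for i j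
        by (intro borel_measurable_continuous_onI continuous_intros)+
      have Y: "(\<lambda>\<tau>. (transpose A *v e k \<tau>) $ i * (transpose A *v e k \<tau>) $ j)
          \<in> borel_measurable (PiM {1..k} (\<lambda>_. borel))"
        by (intro borel_measurable_times measurable_compose[OF 1 vec_nth(1)])
      have G: "(\<lambda>\<tau>. outer_gram (\<tau> (Suc k)) $ i $ j) \<in> borel_measurable (PiM {Suc k} (\<lambda>_. borel))"
        by (rule measurable_compose[OF 2 vec_nth(2)])
      \<comment> \<open>The past draws and the fresh draw form disjoint blocks of an independent
        family.\<close>
      have "indep_var (PiM {1..k} (\<lambda>_. borel)) (\<lambda>\<omega>. restrict (\<lambda>j. T j \<omega>) {1..k})
          (PiM {Suc k} (\<lambda>_. borel)) (\<lambda>\<omega>. restrict (\<lambda>j. T j \<omega>) {Suc k})"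
        by (rule indep_var_restrict[OF ind]) auto
      from indep_var_compose[OF this,
          of "\<lambda>\<tau>. (transpose A *v e k \<tau>) $ i * (transpose A *v e k \<tau>) $ j" borel
             "\<lambda>\<tau>. outer_gram (\<tau> (Suc k)) $ i $ j" borel, OF Y G]
      show ?thesis
        by (simp add: comp_def X_restrict del: transpose_matrix_vector)
    qed
  qed
  define E where "E k = expectation (\<lambda>\<omega>. (norm (X k \<omega>))\<^sup>2)" for k
  \<comment> \<open>The initial residual is constant, and each later squared norm is almost surely
    dominated by its predecessor.\<close>
  have integrable: "integrable M (\<lambda>\<omega>. (norm (X k \<omega>))\<^sup>2)" for k
  proof (induction k)
    case 0
    show ?case by (simp add: X_def e_def)
  next
    case (Suc k)
    show ?case
    proof (rule Bochner_Integration.integrable_bound[OF Suc])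
      show "AE \<omega> in M. norm ((norm (X (Suc k) \<omega>))\<^sup>2) \<le> norm ((norm (X k \<omega>))\<^sup>2)"
        using step[of k]
      proof eventually_elim
        case (elim \<omega>)
        have "0 \<le> c * Q k \<omega>" using c Q_nonneg by simp
        with elim have "(norm (X (Suc k) \<omega>))\<^sup>2 \<le> (norm (X k \<omega>))\<^sup>2" by linarith
        then show ?case by simp
      qed
    qed simp
  qed
  have contraction: "E (Suc k) \<le> eta_c A D \<alpha> * E k" for k
  proof -
    note Q = Q_integral[OF integrable, of k]
    have A_int: "integrable M (\<lambda>\<omega>. (norm (transpose A *v X k \<omega>))\<^sup>2)"
      by (rule integrable_norm_matrix_vector_mult[OF X_meas integrable])
    have "E (Suc k) \<le> expectation (\<lambda>\<omega>. (norm (X k \<omega>))\<^sup>2 - c * Q k \<omega>)"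
      unfolding E_def using Q
      by (intro integral_mono_AE step Bochner_Integration.integrable_diff integrable
          Bochner_Integration.integrable_mult_right) (auto simp: has_bochner_integral_iff)
    also have "\<dots> = E k - c * expectation (\<lambda>\<omega>. (norm (transpose A *v X k \<omega>))\<^sup>2)"
      using Q integrable[of k] by (simp add: E_def has_bochner_integral_iff del: transpose_matrix_vector)
    \<comment> \<open>An auxiliary bound rather than a link of the chain: since \<open>c\<close> is
      positive, scaling by \<open>- c\<close> reverses it and gives the next link.\<close>
    also have "expectation (\<lambda>\<omega>. (sigma_min A)\<^sup>2 * (norm (X k \<omega>))\<^sup>2)
        \<le> expectation (\<lambda>\<omega>. (norm (transpose A *v X k \<omega>))\<^sup>2)"
      by (intro integral_mono A_int Bochner_Integration.integrable_mult_right integrable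
          sigma_min_le_on_range X_range)
    then have "E k - c * expectation (\<lambda>\<omega>. (norm (transpose A *v X k \<omega>))\<^sup>2)
        \<le> E k - c * ((sigma_min A)\<^sup>2 * E k)"
      using c by (simp add: E_def del: transpose_matrix_vector)
    also have "\<dots> = eta_c A D \<alpha> * E k"
      by (simp add: eta_c_def c_def L_def algebra_simps)
    finally show ?thesis .
  qed
  have E_nonneg: "E k \<ge> 0" for k
    unfolding E_def by simp
  have E_0: "E 0 = (norm (A *v (x0 - pinv A *v b)))\<^sup>2"
    by (simp add: E_def X_def e_def prob_space)
  have "E k \<le> eta_c A D \<alpha> ^ k * E 0" for k
  \<comment> \<open>The induction multiplies by \<open>eta_c A D \<alpha>\<close>, whose sign has
    not been established. If it were negative, the contraction together with \<open>E_nonneg\<close>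
    would force every \<open>E k\<close>, including \<open>E 0\<close>, to vanish.\<close>
  proof (cases "eta_c A D \<alpha> \<ge> 0")
    case True
    show ?thesis
    proof (induction k)
      case (Suc k)
      from contraction[of k] mult_left_mono[OF Suc True] show ?case by (simp add: mult_ac)
    qed simp
  next
    case False
    have "E k = 0" for k
    proof -
      have "0 \<le> eta_c A D \<alpha> * E k" using contraction[of k] E_nonneg[of "Suc k"] by simp
      with False E_nonneg[of k] show ?thesis by (auto simp: zero_le_mult_iff)
    qed
    then show ?thesis by simp
  qed
  with integrable show ?thesis
    unfolding E_0 by (simp add: E_def X_def e_def)
qed

end
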